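(* Let $\lambda$ be a partition of $n$, let $i\in\{0,1\}$, let $\mathbf d\in\{0,1\}^n$, let $\mathbf i=(i_1,\dots,i_k)\in\{0,1\}^k$ be an alternating bit string, and let $\mathbf j=(j_1,\dots,j_k)\in\mathbb Z_{\ge0}^k$ be such that $\mathbf i^{\mathbf j}=\mathbf d$. Then $$\big|\mathrm{Tab}^{(i)}(\lambda;\mathbf d)\big|=j_1!\cdots j_k!\;\big|\mathrm{Chess}^{(i^* )}_{\mathbf j}(\lambda)\big|,$$ where $i^*\in\{0,1\}$ is the parity of $i+i_1+1$.
   Context: A bit string is alternating if consecutive entries are distinct. $\mathbf i^{\mathbf j}$ is the bit string $(i_{\sigma(1)},\dots,i_{\sigma(m)})$ with $m=j_1+\cdots+j_k$ and $\sigma(t)=\min\{s\mid j_1+\cdots+j_s\ge t\}$ (i.e. $j_1$ copies of $i_1$, then $j_2$ copies of $i_2$, and so on). A partition $\lambda=(\lambda_0\ge\lambda_1\ge\cdots)$ is identified with its Young diagram, with boxes $(s,t)$ (row $s\ge0$ from the top, column $t\ge0$ from the left), $0\le t<\lambda_s$. For $\epsilon\in\{0,1\}$ the $\epsilon$-parity of the box $(s,t)$ is the parity of $s+t+\epsilon$. A standard tableau of shape $\lambda$ is a filling of the boxes by $1,\dots,n$, each used once, strictly increasing along rows and down columns. Its $i$-parity is the bit string $(d_1,\dots,d_n)$ where $d_t$ is the $i$-parity of the box labeled $t$. $\mathrm{Tab}^{(i)}(\lambda;\mathbf d)$ is the set of standard tableaux of shape $\lambda$ with $i$-parity $\mathbf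 d$. For $\mathbf j\in\mathbb Z_{\ge0}^k$ with $j_1+\cdots+j_k=|\lambda|$, a semi-standard tableau of shape $\lambda$ and content $\mathbf j$ is a labeling of the boxes by integers in $\{1,\dots,k\}$, each $t$ used exactly $j_t$ times, strictly increasing left to right in rows and weakly increasing top to bottom in columns. A chess tableau of shape $\lambda$, parity $\epsilon$ and content $\mathbf j$ is such a semi-standard tableau in which the $\epsilon$-parity of each box equals the parity of its label. $\mathrm{Chess}^{(\epsilon)}_{\mathbf j}(\lambda)$ is the set of these. *)

theory Defs
  imports Main "HOL-Library.FuncSet"
begin

definition bit_strings :: "nat \<Rightarrow> nat list set" where
  "bit_strings n = {ds. length ds = n \<and> set ds \<subseteq> {0, 1}}"

(* Here s and t count entries from 1, whereas list indexing starts at 0.  The value s = 0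
   never satisfies the condition for t \<ge> 1. *)
definition block_index :: "nat list \<Rightarrow> nat \<Rightarrow> nat" where
  "block_index js t = (LEAST s. t \<le> sum_list (take s js))"

definition string_power :: "nat list \<Rightarrow> nat list \<Rightarrow> nat list" where
  "string_power bs js = map (\<lambda>t. bs ! (block_index js t - 1)) [1..<Suc (sum_list js)]"

definition is_partition :: "(nat \<Rightarrow> nat) \<Rightarrow> nat \<Rightarrow> bool" where
  "is_partition lam n \<longleftrightarrow>
     antimono lam \<and> finite {s. lam s \<noteq> 0} \<and> (\<Sum>s\<in>{s. lam s \<noteq> 0}. lam s) = n"

definition diagram :: "(nat \<Rightarrow> nat) \<Rightarrow> (nat \<times> nat) set" where
  "diagram lam = {(s, t). t < lam s}"

definition box_parity :: "nat \<Rightarrow> nat \<times> nat \<Rightarrow> nat" where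
  "box_parity e b = (fst b + snd b + e) mod 2"

definition rows_strict :: "(nat \<Rightarrow> nat) \<Rightarrow> (nat \<times> nat \<Rightarrow> nat) \<Rightarrow> bool" where
  "rows_strict lam T \<longleftrightarrow>
     (\<forall>s t t'. (s, t) \<in> diagram lam \<and> (s, t') \<in> diagram lam \<and> t < t' \<longrightarrow> T (s, t) < T (s, t'))"

definition columns_strict :: "(nat \<Rightarrow> nat) \<Rightarrow> (nat \<times> nat \<Rightarrow> nat) \<Rightarrow> bool" where
  "columns_strict lam T \<longleftrightarrow>
     (\<forall>s s' t. (s, t) \<in> diagram lam \<and> (s', t) \<in> diagram lam \<and> s < s' \<longrightarrow> T (s, t) < T (s', t))"

definition columns_weak :: "(nat \<Rightarrow> nat) \<Rightarrow> (nat \<times> nat \<Rightarrow> nat) \<Rightarrow> bool" where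
  "columns_weak lam T \<longleftrightarrow>
     (\<forall>s s' t. (s, t) \<in> diagram lam \<and> (s', t) \<in> diagram lam \<and> s < s' \<longrightarrow> T (s, t) \<le> T (s', t))"

(* Fillings are extensional functions, i.e. undefined outside the diagram, so that
   a filling of the boxes corresponds to exactly one function and can be counted. *)
definition standard_tableau :: "(nat \<Rightarrow> nat) \<Rightarrow> (nat \<times> nat \<Rightarrow> nat) \<Rightarrow> bool" where
  "standard_tableau lam T \<longleftrightarrow>
     T \<in> extensional (diagram lam) \<and>
     bij_betw T (diagram lam) {1..card (diagram lam)} \<and>
     rows_strict lam T \<and> columns_strict lam T"

definition tableau_parity :: "nat \<Rightarrow> (nat \<Rightarrow> nat) \<Rightarrow> (nat \<times> nat \<Rightarrow> nat) \<Rightarrow> nat list" where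
  "tableau_parity i lam T =
     map (\<lambda>t. box_parity i (inv_into (diagram lam) T t)) [1..<Suc (card (diagram lam))]"

definition Tab :: "nat \<Rightarrow> (nat \<Rightarrow> nat) \<Rightarrow> nat list \<Rightarrow> (nat \<times> nat \<Rightarrow> nat) set" where
  "Tab i lam d = {T. standard_tableau lam T \<and> tableau_parity i lam T = d}"

(* The convention is rows strict and columns weak.  The size condition
   sum_list js = card (diagram lam) follows from the multiplicities. *)
definition semistandard_tableau ::
    "(nat \<Rightarrow> nat) \<Rightarrow> nat list \<Rightarrow> (nat \<times> nat \<Rightarrow> nat) \<Rightarrow> bool" where
  "semistandard_tableau lam js T \<longleftrightarrow>
     T \<in> diagram lam \<rightarrow>\<^sub>E {1..length js} \<and>
     (\<forall>t\<in>{1..length js}. card {b \<in> diagram lam. T b = t} = js ! (t - 1)) \<and>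
     rows_strict lam T \<and> columns_weak lam T"

definition Chess :: "nat \<Rightarrow> nat list \<Rightarrow> (nat \<Rightarrow> nat) \<Rightarrow> (nat \<times> nat \<Rightarrow> nat) set" where
  "Chess e js lam =
     {T. semistandard_tableau lam js T \<and> (\<forall>b\<in>diagram lam. box_parity e b = T b mod 2)}"

end

theory Submission imports Defs begin

text \<open>
  Replacing every label \<open>t\<close> of a standard tableau by the index of the block of \<open>js\<close> containing
  \<open>t\<close> yields a filling with labels in \<open>{1..k}\<close> and content \<open>js\<close>. Since \<open>bs\<close> alternates, its
  \<open>u\<close>-th entry is determined by the parity of \<open>u\<close>, so that a standard tableau has parity string
  \<open>string_power bs js\<close> exactly when the parity of each block index is that of its box, up to the
  global shift by \<open>i + bs ! 0 + 1\<close> (lemmas \<open>tableau_parity_eq_iff\<close> and \<open>alternating_parity_shift\<close>).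

  The order conditions come for free in both directions. Neighbouring boxes of the diagram have
  opposite parities, so under the chess condition neighbouring labels differ, and weak growth
  along rows or columns is strict growth (lemma \<open>chess_strict\<close>). Hence merging the labels of a
  standard tableau block by block gives a chess tableau, although merging alone only preserves
  weak inequalities. Conversely, in a chess tableau the boxes sharing a label are pairwise
  unrelated by the row and column conditions, so the \<open>j\<close> labels of a block may be distributed over
  these \<open>j\<close> boxes in an arbitrary order and the result is always standard.

  The standard tableaux with the given parity string are thus partitioned according to the chess
  tableau they merge to, and each class consists of all bijections from the boxes to \<open>{1..n}\<close>
  compatible with the two colourings by blocks. There are \<open>\<Prod>s<k. fact (js ! s)\<close> of them (lemma
  \<open>card_colour_preserving_injections\<close>).
\<close>

section \<open>Colour-preserving bijections\<close>

text \<open>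
  An injection that preserves colours is the same as an independent choice of an injection on each
  colour class: injections on different classes have disjoint images, as their values carry
  different colours.
\<close>

lemma card_colour_preserving_injections:
  fixes f :: "'a \<Rightarrow> 'c" and g :: "'b \<Rightarrow> 'c"
  assumes "finite A" "finite B" "finite K"
    and f: "f ` A \<subseteq> K"
    and card_eq: "\<And>u. u \<in> K \<Longrightarrow> card {a \<in> A. f a = u} = card {b \<in> B. g b = u}"
  shows "card {T \<in> (\<Pi>\<^sub>E a\<in>A. {b \<in> B. g b = f a}). inj_on T A} =
    (\<Prod>u\<in>K. fact (card {b \<in> B. g b = u}))" (is "card ?S = _")
proof -
  define cA where "cA u = {a \<in> A. f a = u}" for u
  define cB where "cB u = {b \<in> B. g b = u}" for u
  define J where "J u = {T \<in> cA u \<rightarrow>\<^sub>E cB u. inj_on T (cA u)}" for u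
  define split where "split T = (\<lambda>u\<in>K. restrict T (cA u))" for T :: "'a \<Rightarrow> 'b"
  define glue where "glue F = (\<lambda>a\<in>A. F (f a) a)" for F :: "'c \<Rightarrow> 'a \<Rightarrow> 'b"
  have "bij_betw split ?S (Pi\<^sub>E K J)"
  proof (rule bij_betw_byWitness[where f' = glue])
    show "\<forall>T\<in>?S. glue (split T) = T"
      using f by (auto simp: glue_def split_def cA_def fun_eq_iff PiE_def extensional_def)
    show "\<forall>F\<in>Pi\<^sub>E K J. split (glue F) = F"
    proof
      fix F assume F: "F \<in> Pi\<^sub>E K J"
      have "split (glue F) u a = F u a" for u a
      proof (cases "u \<in> K")
        case True
        then have "F u \<in> extensional (cA u)"
          using F by (auto simp: J_def PiE_def Pi_def)
        then show ?thesis
          using True by (auto simp: split_def glue_def cA_def extensional_def)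
      next
        case False
        then show ?thesis
          using F by (auto simp: split_def PiE_def extensional_def)
      qed
      then show "split (glue F) = F" by blast
    qed
    show "split ` ?S \<subseteq> Pi\<^sub>E K J"
      by (auto simp: split_def J_def cA_def cB_def inj_on_def)
    show "glue ` Pi\<^sub>E K J \<subseteq> ?S"
    proof (rule image_subsetI)
      fix F assume F: "F \<in> Pi\<^sub>E K J"
      have val: "F (f a) a \<in> cB (f a)" if "a \<in> A" for a
        using F f that by (fastforce simp: J_def cA_def)
      have inj: "inj_on (F u) (cA u)" if "u \<in> K" for u
        using F that by (auto simp: J_def)
      have "inj_on (glue F) A"
      proof (rule inj_onI)
        fix a a' assume a: "a \<in> A" "a' \<in> A" and eq: "glue F a = glue F a'"
        then have "F (f a) a = F (f a') a'" by (simp add: glue_def)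
        moreover from this have "f a = f a'"
          using val[of a] val[of a'] a by (auto simp: cB_def)
        ultimately show "a = a'"
          using inj[of "f a"] a f by (auto simp: inj_on_def cA_def)
      qed
      then show "glue F \<in> ?S"
        using val by (auto simp: glue_def cB_def)
    qed
  qed
  then have "card ?S = card (Pi\<^sub>E K J)" by (rule bij_betw_same_card)
  also have "\<dots> = (\<Prod>u\<in>K. card (J u))"
    using \<open>finite K\<close> by (rule card_PiE)
  also have "\<dots> = (\<Prod>u\<in>K. fact (card (cB u)))"
  proof (rule prod.cong)
    fix u assume "u \<in> K"
    then have "card (cA u) = card (cB u)" using card_eq by (simp add: cA_def cB_def)
    moreover have "finite (cA u)" "finite (cB u)"
      using assms by (auto simp: cA_def cB_def)
    ultimately show "card (J u) = fact (card (cB u))"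
      using card_inj_on_subset_funcset[of "cA u" "cB u" "cA u"] by (simp add: J_def fact_prod_rev)
  qed simp
  finally show ?thesis by (simp add: cB_def)
qed

section \<open>Blocks of a composition\<close>

lemma sum_list_take_mono:
  fixes js :: "nat list"
  assumes "s \<le> s'"
  shows "sum_list (take s js) \<le> sum_list (take s' js)"
proof -
  have "take s' js = take s js @ take (s' - s) (drop s js)"
    using assms by (metis le_add_diff_inverse take_add)
  then show ?thesis by simp
qed

lemma block_index_le_iff:
  assumes "t \<le> sum_list js"
  shows "block_index js t \<le> u \<longleftrightarrow> t \<le> sum_list (take u js)"
proof
  have "t \<le> sum_list (take (length js) js)" using assms by simp
  then have "t \<le> sum_list (take (block_index js t) js)"
    unfolding block_index_def by (rule LeastI)
  also assume "block_index js t \<le> u"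
  then have "sum_list (take (block_index js t) js) \<le> sum_list (take u js)"
    by (rule sum_list_take_mono)
  finally show "t \<le> sum_list (take u js)" .
next
  assume "t \<le> sum_list (take u js)"
  then show "block_index js t \<le> u"
    unfolding block_index_def by (rule Least_le)
qed

lemma block_index_mono:
  assumes "t \<le> t'" "t' \<le> sum_list js"
  shows "block_index js t \<le> block_index js t'"
  using assms block_index_le_iff[of t' js "block_index js t'"]
    block_index_le_iff[of t js "block_index js t'"] by simp

lemma block_index_range:
  assumes "t \<in> {1..sum_list js}"
  shows "block_index js t \<in> {1..length js}"
  using assms block_index_le_iff[of t js "length js"] block_index_le_iff[of t js 0]
  by (auto simp: Suc_le_eq)

lemma card_block:
  assumes "u \<in> {1..length js}"
  shows "card {t \<in> {1..sum_list js}. block_index js t = u} = js ! (u - 1)"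
proof -
  have take_u: "sum_list (take u js) = sum_list (take (u - 1) js) + js ! (u - 1)"
    using assms by (cases u) (auto simp: take_Suc_conv_app_nth)
  have le: "sum_list (take u js) \<le> sum_list js"
    using sum_list_take_mono[of u "length js" js] assms by simp
  have iff: "t \<le> sum_list js \<and> block_index js t = u \<longleftrightarrow>
      sum_list (take (u - 1) js) < t \<and> t \<le> sum_list (take u js)" for t
  proof (cases "t \<le> sum_list js")
    case True
    then show ?thesis
      using block_index_le_iff[OF True, of u] block_index_le_iff[OF True, of "u - 1"] assms by auto
  next
    case False
    then show ?thesis using le by simp
  qed
  have "{t \<in> {1..sum_list js}. block_index js t = u} =
      {t. 1 \<le> t \<and> t \<le> sum_list js \<and> block_index js t = u}"
    by auto
  also have "\<dots> = {sum_list (take (u - 1) js)<..sum_list (take u js)}"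
    unfolding iff by auto
  finally have "{t \<in> {1..sum_list js}. block_index js t = u} =
      {sum_list (take (u - 1) js)<..sum_list (take u js)}" .
  then show ?thesis using take_u by simp
qed

section \<open>Parities\<close>

lemma alternating_nth:
  assumes "set bs \<subseteq> {0, 1}" "distinct_adj bs" "m < length bs"
  shows "bs ! m = (bs ! 0 + m) mod (2::nat)"
  using assms(3)
proof (induction m)
  case 0
  then have "bs ! 0 \<in> {0, 1}" using assms(1) nth_mem by blast
  then show ?case by auto
next
  case (Suc m)
  have "bs ! Suc m = 0 \<or> bs ! Suc m = 1"
    using Suc.prems assms(1) nth_mem by blast
  moreover have "bs ! Suc m \<noteq> bs ! m"
    using Suc.prems assms(2) distinct_adj_nth by metis
  moreover have "bs ! m = (bs ! 0 + m) mod 2" using Suc by simp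
  ultimately show ?case by presburger
qed

text \<open>The summand \<open>1\<close> in the shift compensates for labels of chess tableaux starting at \<open>1\<close>.\<close>

lemma alternating_parity_shift:
  assumes "set bs \<subseteq> {0, 1}" "distinct_adj bs" "u \<in> {1..length bs}"
  shows "box_parity i b = bs ! (u - 1) \<longleftrightarrow> box_parity ((i + bs ! 0 + 1) mod 2) b = u mod 2"
proof -
  obtain m where m: "u = Suc m" "m < length bs" using assms(3) by (cases u) auto
  then have "bs ! (u - 1) = (bs ! 0 + m) mod 2"
    using alternating_nth[OF assms(1,2)] by simp
  then show ?thesis by (auto simp: box_parity_def m(1) mod2_eq_if)
qed

lemma box_parity_neighbour:
  "box_parity e (s, Suc t) \<noteq> box_parity e (s, t)"
  "box_parity e (Suc s, t) \<noteq> box_parity e (s, t)"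
  by (simp_all add: box_parity_def mod_Suc)

lemma tableau_parity_eq_iff:
  assumes T: "bij_betw T (diagram lam) {1..card (diagram lam)}"
    and card: "card (diagram lam) = sum_list js"
  shows "tableau_parity i lam T = string_power bs js \<longleftrightarrow>
    (\<forall>b\<in>diagram lam. box_parity i b = bs ! (block_index js (T b) - 1))"
proof -
  let ?D = "diagram lam"
  have "tableau_parity i lam T = string_power bs js \<longleftrightarrow>
      (\<forall>t\<in>{1..card ?D}. box_parity i (inv_into ?D T t) = bs ! (block_index js t - 1))"
    by (auto simp: tableau_parity_def string_power_def card)
  also have "{1..card ?D} = T ` ?D"
    using T by (rule bij_betw_imp_surj_on[symmetric])
  also have "(\<forall>t\<in>T ` ?D. box_parity i (inv_into ?D T t) = bs ! (block_index js t - 1)) \<longleftrightarrow>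
      (\<forall>b\<in>?D. box_parity i b = bs ! (block_index js (T b) - 1))"
    using bij_betw_imp_inj_on[OF T] by simp
  finally show ?thesis .
qed

section \<open>Diagrams and order conditions\<close>

lemma diagram_row_closed: "(s, t') \<in> diagram lam \<Longrightarrow> t \<le> t' \<Longrightarrow> (s, t) \<in> diagram lam"
  by (simp add: diagram_def)

lemma diagram_column_closed:
  assumes "antimono lam" "(s', t) \<in> diagram lam" "s \<le> s'"
  shows "(s, t) \<in> diagram lam"
  using antimonoD[OF assms(1,3)] assms(2) by (simp add: diagram_def)

lemma is_partition_finite_card_diagram:
  assumes "is_partition lam n"
  shows "finite (diagram lam)" "card (diagram lam) = n"
proof -
  have "diagram lam = (SIGMA s:{s. lam s \<noteq> 0}. {..<lam s})"
    by (auto simp: diagram_def)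
  then show "finite (diagram lam)" "card (diagram lam) = n"
    using assms by (auto simp: is_partition_def)
qed

definition rows_weak :: "(nat \<Rightarrow> nat) \<Rightarrow> (nat \<times> nat \<Rightarrow> nat) \<Rightarrow> bool" where
  "rows_weak lam T \<longleftrightarrow>
     (\<forall>s t t'. (s, t) \<in> diagram lam \<and> (s, t') \<in> diagram lam \<and> t < t' \<longrightarrow> T (s, t) \<le> T (s, t'))"

text \<open>
  The two ends of a weakly increasing segment are separated by its first two boxes, which have
  opposite parities and hence different labels.
\<close>

lemma chess_strict:
  assumes parity: "\<forall>b\<in>diagram lam. box_parity e b = U b mod 2"
  shows "rows_weak lam U \<Longrightarrow> rows_strict lam U"
    and "antimono lam \<Longrightarrow> columns_weak lam U \<Longrightarrow> columns_strict lam U"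
proof -
  assume weak: "rows_weak lam U"
  show "rows_strict lam U"
    unfolding rows_strict_def
  proof (intro allI impI, elim conjE)
    fix s t t' assume D: "(s, t) \<in> diagram lam" "(s, t') \<in> diagram lam" and less: "t < t'"
    then have D1: "(s, Suc t) \<in> diagram lam" using diagram_row_closed[of s t' lam "Suc t"] by simp
    have "U (s, t) \<noteq> U (s, Suc t)"
      using parity D(1) D1 box_parity_neighbour[of e s t] by metis
    moreover have "U (s, t) \<le> U (s, Suc t)"
      using weak D D1 by (simp add: rows_weak_def)
    moreover have "U (s, Suc t) \<le> U (s, t')"
      using weak D D1 less by (cases "Suc t = t'") (auto simp: rows_weak_def)
    ultimately show "U (s, t) < U (s, t')" by linarith
  qed
next
  assume anti: "antimono lam" and weak: "columns_weak lam U"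
  show "columns_strict lam U"
    unfolding columns_strict_def
  proof (intro allI impI, elim conjE)
    fix s s' t assume D: "(s, t) \<in> diagram lam" "(s', t) \<in> diagram lam" and less: "s < s'"
    then have D1: "(Suc s, t) \<in> diagram lam"
      using diagram_column_closed[OF anti, of s' t "Suc s"] by simp
    have "U (s, t) \<noteq> U (Suc s, t)"
      using parity D(1) D1 box_parity_neighbour[of e s t] by metis
    moreover have "U (s, t) \<le> U (Suc s, t)"
      using weak D D1 by (simp add: columns_weak_def)
    moreover have "U (Suc s, t) \<le> U (s', t)"
      using weak D D1 less by (cases "Suc s = s'") (auto simp: columns_weak_def)
    ultimately show "U (s, t) < U (s', t)" by linarith
  qed
qed

section \<open>Standard tableaux over a chess tableau\<close>

definition merge_blocks ::
    "(nat \<Rightarrow> nat) \<Rightarrow> nat list \<Rightarrow> (nat \<times> nat \<Rightarrow> nat) \<Rightarrow> nat \<times> nat \<Rightarrow> nat" where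
  "merge_blocks lam js T = (\<lambda>b\<in>diagram lam. block_index js (T b))"

text \<open>
  The possible labellings whose blocks merge to \<open>U\<close>. Injectivity makes them bijections onto
  \<open>{1..sum_list js}\<close> whenever the diagram has \<open>sum_list js\<close> boxes; in this form they are counted by
  \<open>card_colour_preserving_injections\<close>, with \<open>U\<close> colouring the boxes and \<open>block_index js\<close> the labels.
\<close>

definition refinements ::
    "(nat \<Rightarrow> nat) \<Rightarrow> nat list \<Rightarrow> (nat \<times> nat \<Rightarrow> nat) \<Rightarrow> (nat \<times> nat \<Rightarrow> nat) set" where
  "refinements lam js U =
     {T \<in> (\<Pi>\<^sub>E b\<in>diagram lam. {t \<in> {1..sum_list js}. block_index js t = U b}).
        inj_on T (diagram lam)}"

lemma merge_blocks_refinement: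
  assumes "T \<in> refinements lam js U" "U \<in> extensional (diagram lam)"
  shows "merge_blocks lam js T = U"
  using assms by (fastforce simp: refinements_def merge_blocks_def fun_eq_iff extensional_def)

context
  fixes lam :: "nat \<Rightarrow> nat" and bs js :: "nat list"
  assumes anti: "antimono lam"
    and finite_diagram: "finite (diagram lam)"
    and card_diagram: "card (diagram lam) = sum_list js"
    and bits: "set bs \<subseteq> {0, 1}"
    and alternating: "distinct_adj bs"
    and length_eq: "length js = length bs"
begin

lemma merge_blocks_in_Chess:
  assumes "T \<in> Tab i lam (string_power bs js)"
  shows "merge_blocks lam js T \<in> Chess ((i + bs ! 0 + 1) mod 2) js lam"
    and "T \<in> refinements lam js (merge_blocks lam js T)"
proof -
  let ?D = "diagram lam" and ?U = "merge_blocks lam js T" and ?e = "(i + bs ! 0 + 1) mod 2"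
  have ext: "T \<in> extensional ?D" and bij: "bij_betw T ?D {1..sum_list js}"
    and rows: "rows_strict lam T" and columns: "columns_strict lam T"
    and par: "tableau_parity i lam T = string_power bs js"
    using assms by (simp_all add: Tab_def standard_tableau_def card_diagram)
  have T_range: "T b \<in> {1..sum_list js}" if "b \<in> ?D" for b
    using bij that by (rule bij_betwE[THEN bspec])
  have U: "?U b = block_index js (T b)" if "b \<in> ?D" for b
    using that by (simp add: merge_blocks_def)
  have U_range: "?U \<in> ?D \<rightarrow>\<^sub>E {1..length js}"
    unfolding merge_blocks_def using T_range block_index_range by (simp add: restrict_PiE_iff)
  have U_mono: "?U b \<le> ?U b'" if "b \<in> ?D" "b' \<in> ?D" "T b < T b'" for b b'
    using that T_range[of b'] by (simp add: U block_index_mono)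
  have chess: "\<forall>b\<in>?D. box_parity ?e b = ?U b mod 2"
  proof
    fix b assume b: "b \<in> ?D"
    have "box_parity i b = bs ! (?U b - 1)"
      using par tableau_parity_eq_iff[of T lam js i bs] bij b by (simp add: card_diagram U)
    moreover have "?U b \<in> {1..length bs}"
      using b U_range length_eq by auto
    ultimately show "box_parity ?e b = ?U b mod 2"
      using alternating_parity_shift[OF bits alternating] by blast
  qed
  \<comment> \<open>Merging keeps only the weak inequalities in rows; the parities restore strictness.\<close>
  have "rows_weak lam ?U"
    using rows U_mono by (auto simp: rows_weak_def rows_strict_def)
  then have "rows_strict lam ?U" by (rule chess_strict(1)[OF chess])
  moreover have "columns_weak lam ?U"
    using columns U_mono by (auto simp: columns_weak_def columns_strict_def)
  moreover have "card {b \<in> ?D. ?U b = u} = js ! (u - 1)" if u: "u \<in> {1..length js}" for u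
  proof -
    have "bij_betw T {b \<in> ?D. ?U b = u} {t \<in> {1..sum_list js}. block_index js t = u}"
      using bij by (rule bij_betw_Collect) (simp add: U)
    then show ?thesis
      using card_block[OF u] by (simp add: bij_betw_same_card)
  qed
  ultimately show "?U \<in> Chess ?e js lam"
    using U_range chess by (simp add: Chess_def semistandard_tableau_def)
  show "T \<in> refinements lam js ?U"
    using ext T_range bij_betw_imp_inj_on[OF bij] by (auto simp: refinements_def U PiE_iff)
qed

text \<open>
  Boxes with different chess labels receive labels from different blocks, in the same order; by
  strictness this settles every pair of boxes that a standard tableau compares.
\<close>

lemma refinements_subset_Tab:
  assumes chess: "U \<in> Chess ((i + bs ! 0 + 1) mod 2) js lam" and T: "T \<in> refinements lam js U"
  shows "T \<in> Tab i lam (string_power bs js)"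
proof -
  let ?D = "diagram lam" and ?e = "(i + bs ! 0 + 1) mod 2"
  have U_range: "U b \<in> {1..length js}" if "b \<in> ?D" for b
    using chess that by (auto simp: Chess_def semistandard_tableau_def)
  have rows: "rows_strict lam U" and parity: "\<forall>b\<in>?D. box_parity ?e b = U b mod 2"
    using chess by (auto simp: Chess_def semistandard_tableau_def)
  \<comment> \<open>Strictness keeps boxes of one column in different blocks, whose labels are then ordered.\<close>
  have columns: "columns_strict lam U"
    using chess chess_strict(2)[OF parity anti] by (simp add: Chess_def semistandard_tableau_def)
  have ext: "T \<in> extensional ?D" and inj: "inj_on T ?D"
    and T_range: "\<And>b. b \<in> ?D \<Longrightarrow> T b \<in> {1..sum_list js}"
    and T_block: "\<And>b. b \<in> ?D \<Longrightarrow> block_index js (T b) = U b"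
    using T by (auto simp: refinements_def PiE_iff)
  have less: "T b < T b'" if "b \<in> ?D" "b' \<in> ?D" "U b < U b'" for b b'
    using that block_index_mono[of "T b'" "T b" js] T_range[of b] T_block[of b] T_block[of b']
    by (metis atLeastAtMost_iff leD not_le_imp_less)
  have "T ` ?D = {1..sum_list js}"
    using T_range card_image[OF inj] card_diagram by (intro card_subset_eq) auto
  then have bij: "bij_betw T ?D {1..card ?D}"
    using inj by (simp add: bij_betw_def card_diagram)
  have "rows_strict lam T" "columns_strict lam T"
    using rows columns less by (simp_all add: rows_strict_def columns_strict_def)
  moreover have "tableau_parity i lam T = string_power bs js"
    unfolding tableau_parity_eq_iff[OF bij card_diagram]
  proof
    fix b assume b: "b \<in> ?D"
    then show "box_parity i b = bs ! (block_index js (T b) - 1)"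
      using alternating_parity_shift[OF bits alternating, of "U b" i b] U_range parity T_block
        length_eq by simp
  qed
  ultimately show ?thesis
    using ext bij by (simp add: Tab_def standard_tableau_def)
qed

lemma card_refinements:
  assumes "U \<in> Chess e js lam"
  shows "card (refinements lam js U) = (\<Prod>s<length js. fact (js ! s))"
proof -
  have "card (refinements lam js U) =
      (\<Prod>u\<in>{1..length js}. fact (card {t \<in> {1..sum_list js}. block_index js t = u}))"
    unfolding refinements_def
    using assms finite_diagram card_block
    by (intro card_colour_preserving_injections)
      (auto simp: Chess_def semistandard_tableau_def)
  also have "\<dots> = (\<Prod>u\<in>{1..length js}. fact (js ! (u - 1)))"
    using card_block by (intro prod.cong) simp_all
  also have "\<dots> = (\<Prod>s<length js. fact (js ! s))"
    by (simp add: prod.atLeast1_atMost_eq)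
  finally show ?thesis .
qed

lemma card_Tab_string_power:
  "card (Tab i lam (string_power bs js)) =
     (\<Prod>s<length js. fact (js ! s)) * card (Chess ((i + bs ! 0 + 1) mod 2) js lam)"
proof -
  let ?C = "Chess ((i + bs ! 0 + 1) mod 2) js lam"
  have "?C \<subseteq> diagram lam \<rightarrow>\<^sub>E {1..length js}"
    by (auto simp: Chess_def semistandard_tableau_def)
  then have finite_C: "finite ?C"
    by (rule finite_subset) (simp add: finite_PiE finite_diagram)
  have finite_ref: "finite (refinements lam js U)" if "U \<in> ?C" for U
    using card_refinements[OF that] by (intro card_ge_0_finite) (simp add: prod_pos)
  have extensional: "U \<in> extensional (diagram lam)" if "U \<in> ?C" for U
    using that by (auto simp: Chess_def semistandard_tableau_def PiE_iff)
  have disjoint: "refinements lam js U \<inter> refinements lam js V = {}"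
    if "U \<in> ?C" "V \<in> ?C" "U \<noteq> V" for U V
    using that extensional merge_blocks_refinement by blast
  have "Tab i lam (string_power bs js) = (\<Union>U\<in>?C. refinements lam js U)"
    using merge_blocks_in_Chess refinements_subset_Tab by blast
  then have "card (Tab i lam (string_power bs js)) = (\<Sum>U\<in>?C. card (refinements lam js U))"
    using finite_C finite_ref disjoint by (simp add: card_UN_disjoint)
  also have "\<dots> = (\<Prod>s<length js. fact (js ! s)) * card ?C"
    using card_refinements by simp
  finally show ?thesis .
qed

end

theorem proposition1:
  fixes lam :: "nat \<Rightarrow> nat" and n k i :: nat and d bs js :: "nat list"
  assumes "is_partition lam n"
    and "i \<in> {0, 1}"
    and "d \<in> bit_strings n"
    and "1 \<le> k"
    and "bs \<in> bit_strings k"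
    and "distinct_adj bs"
    and "length js = k"
    and "string_power bs js = d"
  shows "card (Tab i lam d) = (\<Prod>s<k. fact (js ! s)) * card (Chess ((i + bs ! 0 + 1) mod 2) js lam)"
proof -
  have "length d = sum_list js"
    unfolding assms(8)[symmetric] by (simp add: string_power_def del: upt_Suc)
  then have "card (diagram lam) = sum_list js"
    using assms(1,3) by (simp add: bit_strings_def is_partition_finite_card_diagram)
  then have "card (Tab i lam (string_power bs js)) =
      (\<Prod>s<length js. fact (js ! s)) * card (Chess ((i + bs ! 0 + 1) mod 2) js lam)"
    using assms is_partition_finite_card_diagram(1)[OF assms(1)]
    by (intro card_Tab_string_power) (auto simp: bit_strings_def is_partition_def)
  then show ?thesis using assms(7,8) by simp
qed

end
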